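(* Let $S$ be the unique formal power series in the variables $t_1,t_2,\dots$ satisfying $S=1+\sum_{n=1}^\infty t_nS^n$, let $S_1=\sum_{n=1}^\infty t_n$, let $G=(S-1)/S_1$, and let $H=G/S$. Then $H$ is the generating function for positive paths, i.e. $H=\sum_P w(P)$, where the sum is over all positive paths $P$ with steps in $\{-1,0,1,2,\dots\}$ and $w(P)$ is the weight of $P$.
   Context: A path is a finite (possibly empty) sequence $(s_1,\dots,s_k)$ of integers, called its steps; here all steps are in $\{-1,0,1,2,\dots\}$. A path is positive if every nonempty partial sum $s_1+\cdots+s_i$ ($1\le i\le k$) is positive; in particular the empty path is positive. The weight of a step $n\ge 0$ is $t_{n+1}$, the weight of the step $-1$ is $1$, and the weight $w(P)$ of a path $P$ is the product of the weights of its steps (the empty path has weight $1$). The generating function for a set of paths is the sum of their weights, as a formal power series in the infinitely many commuting variables $t_1,t_2,\dots$ (arbitrary formal, possibly infinite, linear combinations of monomials). The ring of such power series (over the integers or the rationals) is an integral domain, and $G$ and $H$ are defined a priori as elements of its field of fractions. *)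

theory Defs
  imports
    "HOL-Library.Multiset_Order"
    "HOL-Computational_Algebra.Fraction_Field"
begin

section \<open>Formal power series in arbitrarily many commuting variables\<close>

text \<open>
  A monomial in the variables \<^typ>\<open>'v\<close> is a finite multiset of variables; multiplication of
  monomials is multiset union and the monomial 1 is the empty multiset.  A formal power series is
  an arbitrary family of coefficients indexed by the monomials.
\<close>

typedef ('v, 'a) mps = "{f :: 'v multiset \<Rightarrow> 'a. True}"
  morphisms mps_coeff Abs_mps
  by simp

lemma mps_eqI: "(\<And>m. mps_coeff f m = mps_coeff g m) \<Longrightarrow> f = g"
  by (auto simp flip: mps_coeff_inject)

lemma mps_eq_iff: "f = g \<longleftrightarrow> (\<forall>m. mps_coeff f m = mps_coeff g m)"
  by (auto intro: mps_eqI)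

lemma mps_coeff_Abs [simp]: "mps_coeff (Abs_mps f) = f"
  by (simp add: Abs_mps_inverse)

definition splits :: "'v multiset \<Rightarrow> ('v multiset \<times> 'v multiset) set" where
  "splits m = {(a, b). a + b = m}"

lemma mem_splits_iff: "(a, b) \<in> splits m \<longleftrightarrow> a + b = m"
  by (simp add: splits_def)

lemma finite_submultisets: "finite {a. a \<subseteq># m}"
proof (rule finite_subset)
  show "{a. a \<subseteq># m} \<subseteq> mset ` {xs. set xs \<subseteq> set_mset m \<and> length xs \<le> size m}"
  proof
    fix a assume "a \<in> {a. a \<subseteq># m}"
    moreover obtain xs where "a = mset xs"
      using ex_mset by metis
    ultimately show "a \<in> mset ` {xs. set xs \<subseteq> set_mset m \<and> length xs \<le> size m}"
      using set_mset_mono size_mset_mono by fastforce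
  qed
  show "finite (mset ` {xs. set xs \<subseteq> set_mset m \<and> length xs \<le> size m})"
    by (intro finite_imageI finite_lists_length_le) simp
qed

lemma finite_splits [simp]: "finite (splits m)"
proof (rule finite_subset)
  show "splits m \<subseteq> {a. a \<subseteq># m} \<times> {a. a \<subseteq># m}"
    by (auto simp: splits_def)
  show "finite ({a. a \<subseteq># m} \<times> {a. a \<subseteq># m})"
    by (simp add: finite_submultisets)
qed

lemma splits_empty [simp]: "splits {#} = {({#}, {#})}"
  by (auto simp: splits_def)

instantiation mps :: (type, comm_ring_1) comm_ring_1
begin

definition "0 = Abs_mps (\<lambda>_. 0)"
definition "1 = Abs_mps (\<lambda>m. if m = {#} then 1 else 0)"
definition "f + g = Abs_mps (\<lambda>m. mps_coeff f m + mps_coeff g m)"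
definition "- f = Abs_mps (\<lambda>m. - mps_coeff f m)"
definition "f - g = Abs_mps (\<lambda>m. mps_coeff f m - mps_coeff g m)"
definition "f * g = Abs_mps (\<lambda>m. \<Sum>(a, b)\<in>splits m. mps_coeff f a * mps_coeff g b)"

instance
proof
  fix f g h :: "('a, 'b) mps"
  show "f + g + h = f + (g + h)" "f + g = g + f" "0 + f = f" "- f + f = 0" "f - g = f + - g"
    by (auto simp: mps_eq_iff plus_mps_def zero_mps_def uminus_mps_def minus_mps_def)
  show "(f + g) * h = f * h + g * h"
    by (auto simp: mps_eq_iff plus_mps_def times_mps_def distrib_right case_prod_unfold
        sum.distrib)
  show "(0 :: ('a, 'b) mps) \<noteq> 1"
    by (auto simp: mps_eq_iff zero_mps_def one_mps_def)
  show "f * g = g * f"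
  proof (rule mps_eqI)
    fix m
    have "(\<Sum>(a, b)\<in>splits m. mps_coeff f a * mps_coeff g b) =
          (\<Sum>(a, b)\<in>splits m. mps_coeff g a * mps_coeff f b)"
      by (rule sum.reindex_bij_witness[of _ prod.swap prod.swap])
         (auto simp: splits_def ac_simps)
    then show "mps_coeff (f * g) m = mps_coeff (g * f) m"
      by (simp add: times_mps_def)
  qed
  show "1 * f = f"
  proof (rule mps_eqI)
    fix m
    have "(\<Sum>(a, b)\<in>splits m. mps_coeff 1 a * mps_coeff f b) =
          (\<Sum>(a, b)\<in>{({#}, m)}. mps_coeff 1 a * mps_coeff f b)"
      by (rule sum.mono_neutral_right) (auto simp: mem_splits_iff one_mps_def split: if_splits)
    then show "mps_coeff (1 * f) m = mps_coeff f m"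
      by (simp add: times_mps_def one_mps_def)
  qed
  show "f * g * h = f * (g * h)"
  proof (rule mps_eqI)
    fix m
    let ?F = "mps_coeff f" and ?G = "mps_coeff g" and ?H = "mps_coeff h"
    have "mps_coeff (f * g * h) m =
          (\<Sum>p\<in>splits m. \<Sum>q\<in>splits (fst p). ?F (fst q) * ?G (snd q) * ?H (snd p))"
      by (simp add: times_mps_def case_prod_unfold sum_distrib_right)
    also have "\<dots> = (\<Sum>(p, q)\<in>Sigma (splits m) (\<lambda>p. splits (fst p)).
                      ?F (fst q) * ?G (snd q) * ?H (snd p))"
      by (subst sum.Sigma) auto
    also have "\<dots> = (\<Sum>(p, q)\<in>Sigma (splits m) (\<lambda>p. splits (snd p)).
                      ?F (fst p) * (?G (fst q) * ?H (snd q)))"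
      by (rule sum.reindex_bij_witness[of _
            "\<lambda>((a, _), (b, c)). ((a + b, c), (a, b))" "\<lambda>((_, c), (a, b)). ((a, b + c), (b, c))"])
         (auto simp: splits_def ac_simps)
    also have "\<dots> = (\<Sum>p\<in>splits m. \<Sum>q\<in>splits (snd p). ?F (fst p) * (?G (fst q) * ?H (snd q)))"
      by (subst sum.Sigma) auto
    also have "\<dots> = mps_coeff (f * (g * h)) m"
      by (simp add: times_mps_def case_prod_unfold sum_distrib_left)
    finally show "mps_coeff (f * g * h) m = mps_coeff (f * (g * h)) m" .
  qed
qed

end

lemma mps_coeff_zero [simp]: "mps_coeff 0 m = 0"
  by (simp add: zero_mps_def)

lemma mps_coeff_one: "mps_coeff 1 m = (if m = {#} then 1 else 0)"
  by (simp add: one_mps_def)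

lemma mps_coeff_add [simp]: "mps_coeff (f + g) m = mps_coeff f m + mps_coeff g m"
  by (simp add: plus_mps_def)

lemma mps_coeff_uminus [simp]: "mps_coeff (- f) m = - mps_coeff f m"
  by (simp add: uminus_mps_def)

lemma mps_coeff_diff [simp]: "mps_coeff (f - g) m = mps_coeff f m - mps_coeff g m"
  by (simp add: minus_mps_def)

lemma mps_coeff_mult: "mps_coeff (f * g) m = (\<Sum>(a, b)\<in>splits m. mps_coeff f a * mps_coeff g b)"
  by (simp add: times_mps_def)

text \<open>
  The ring is an integral domain: the multiset order is a well-order compatible with
  multiplication of monomials, so the least monomials of two nonzero series multiply to the
  least monomial of the product.
\<close>

instance mps :: (wellorder, idom) idom
proof
  fix f g :: "('a, 'b) mps"
  assume "f \<noteq> 0" "g \<noteq> 0"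
  then have ex: "\<exists>m. mps_coeff f m \<noteq> 0" "\<exists>m. mps_coeff g m \<noteq> 0"
    by (auto simp: mps_eq_iff)
  define m where "m = (LEAST m. mps_coeff f m \<noteq> 0)"
  define n where "n = (LEAST n. mps_coeff g n \<noteq> 0)"
  have nz: "mps_coeff f m \<noteq> 0" "mps_coeff g n \<noteq> 0"
    unfolding m_def n_def by (rule LeastI_ex, fact ex)+
  have least: "mps_coeff f a \<noteq> 0 \<Longrightarrow> m \<le> a" "mps_coeff g a \<noteq> 0 \<Longrightarrow> n \<le> a" for a
    unfolding m_def n_def by (auto intro: Least_le)
  have vanish: "mps_coeff f a * mps_coeff g b = 0" if "a + b = m + n" "(a, b) \<noteq> (m, n)" for a b
  proof (rule ccontr)
    assume "mps_coeff f a * mps_coeff g b \<noteq> 0"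
    then have "m \<le> a" "n \<le> b"
      using least by auto
    have "a = m"
    proof (rule ccontr)
      assume "a \<noteq> m"
      with \<open>m \<le> a\<close> have "m < a"
        by simp
      then have "m + n < a + b"
        using \<open>n \<le> b\<close> by (rule add_less_le_mono)
      with that(1) show False
        by simp
    qed
    with that show False
      by simp
  qed
  have "mps_coeff (f * g) (m + n) = (\<Sum>(a, b)\<in>{(m, n)}. mps_coeff f a * mps_coeff g b)"
    unfolding mps_coeff_mult
    by (rule sum.mono_neutral_right) (use vanish in \<open>force simp: mem_splits_iff\<close>)+
  with nz have "mps_coeff (f * g) (m + n) \<noteq> 0"
    by simp
  then show "f * g \<noteq> 0"
    by (metis mps_coeff_zero)
qed

definition mps_var :: "'v \<Rightarrow> ('v, 'a :: comm_ring_1) mps" where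
  "mps_var v = Abs_mps (\<lambda>m. if m = {#v#} then 1 else 0)"

lemma mps_coeff_var: "mps_coeff (mps_var v) m = (if m = {#v#} then 1 else 0)"
  by (simp add: mps_var_def)

text \<open>
  Infinite sums of formal power series are taken coefficientwise.  They are meaningful if every
  monomial has a nonzero coefficient in only finitely many summands.
\<close>

definition formally_summable :: "('i \<Rightarrow> ('v, 'a :: comm_ring_1) mps) \<Rightarrow> 'i set \<Rightarrow> bool" where
  "formally_summable f I \<longleftrightarrow> (\<forall>m. finite {i \<in> I. mps_coeff (f i) m \<noteq> 0})"

definition formal_sum :: "('i \<Rightarrow> ('v, 'a :: comm_ring_1) mps) \<Rightarrow> 'i set \<Rightarrow> ('v, 'a) mps" where
  "formal_sum f I = Abs_mps (\<lambda>m. \<Sum>i | i \<in> I \<and> mps_coeff (f i) m \<noteq> 0. mps_coeff (f i) m)"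

definition to_fract :: "'a :: idom \<Rightarrow> 'a fract" where
  "to_fract x = Fract x 1"


section \<open>The series \<open>S\<close>\<close>

text \<open>
  The variables are \<open>t\<^sub>1, t\<^sub>2, \<dots>\<close>, while \<^typ>\<open>nat\<close> starts at 0, so \<open>t\<^sub>n\<close> is the variable
  with index \<open>n - 1\<close>.  The value \<open>t 0\<close> is meaningless and never used.
\<close>

definition t :: "nat \<Rightarrow> (nat, 'a :: comm_ring_1) mps" where
  "t n = mps_var (n - 1)"

lemma mps_coeff_t_mult:
  assumes "n \<ge> 1"
  shows "mps_coeff (t n * f) m = (if n - 1 \<in># m then mps_coeff f (m - {#n - 1#}) else 0)"
proof -
  have "mps_coeff (t n * f) m =
        (\<Sum>(a, b)\<in>(if n - 1 \<in># m then {({#n - 1#}, m - {#n - 1#})} else {}).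
          mps_coeff (t n) a * mps_coeff f b)"
    unfolding mps_coeff_mult
    by (rule sum.mono_neutral_right) (auto simp: mem_splits_iff t_def mps_coeff_var split: if_splits)
  then show ?thesis
    by (simp add: t_def mps_coeff_var)
qed

lemma mps_coeff_t_mult_nonzero:
  "{n \<in> {1..}. mps_coeff (t n * f n) m \<noteq> 0} \<subseteq> Suc ` set_mset m"
proof
  fix n assume "n \<in> {n \<in> {1..}. mps_coeff (t n * f n) m \<noteq> 0}"
  then have "n \<ge> 1" "n - 1 \<in># m"
    by (auto simp: mps_coeff_t_mult split: if_splits)
  then show "n \<in> Suc ` set_mset m"
    by (intro image_eqI[of _ _ "n - 1"]) auto
qed

lemma formally_summable_t_mult: "formally_summable (\<lambda>n. t n * f n) {1..}"
  unfolding formally_summable_def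
  by (intro allI finite_subset[OF mps_coeff_t_mult_nonzero]) simp

lemma mps_coeff_formal_sum_t_mult:
  "mps_coeff (formal_sum (\<lambda>n. t n * f n) {1..}) m =
   (\<Sum>v\<in>set_mset m. mps_coeff (f (Suc v)) (m - {#v#}))"
proof -
  have "mps_coeff (formal_sum (\<lambda>n. t n * f n) {1..}) m =
        (\<Sum>n | n \<in> {1..} \<and> mps_coeff (t n * f n) m \<noteq> 0. mps_coeff (t n * f n) m)"
    by (simp add: formal_sum_def)
  also have "\<dots> = (\<Sum>n\<in>Suc ` set_mset m. mps_coeff (t n * f n) m)"
    using mps_coeff_t_mult_nonzero[of f m] by (intro sum.mono_neutral_left) auto
  also have "\<dots> = (\<Sum>v\<in>set_mset m. mps_coeff (f (Suc v)) (m - {#v#}))"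
    by (subst sum.reindex) (auto simp: mps_coeff_t_mult intro!: sum.cong)
  finally show ?thesis .
qed

definition S_equation :: "(nat, 'a :: comm_ring_1) mps \<Rightarrow> bool" where
  "S_equation S \<longleftrightarrow> S = 1 + formal_sum (\<lambda>n. t n * S ^ n) {1..}"

lemma mps_coeff_power_cong:
  assumes "\<And>a. a \<subseteq># m \<Longrightarrow> mps_coeff f a = mps_coeff g a"
  shows "mps_coeff (f ^ k) m = mps_coeff (g ^ k) m"
  using assms
proof (induction k arbitrary: m)
  case (Suc k)
  have "mps_coeff f a * mps_coeff (f ^ k) b = mps_coeff g a * mps_coeff (g ^ k) b"
    if ab: "a + b = m" for a b
  proof -
    have sub: "a \<subseteq># m" "b \<subseteq># m"
      using ab by auto
    then have "mps_coeff (f ^ k) b = mps_coeff (g ^ k) b"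
      by (intro Suc.IH Suc.prems) (auto intro: subset_mset.order_trans)
    with sub Suc.prems show ?thesis
      by simp
  qed
  then show ?case
    by (auto simp: mps_coeff_mult splits_def intro!: sum.cong)
qed simp

lemma S_step_cong:
  fixes f g :: "(nat, 'a :: comm_ring_1) mps"
  assumes "\<And>a. size a < size m \<Longrightarrow> mps_coeff f a = mps_coeff g a"
  shows "mps_coeff (1 + formal_sum (\<lambda>n. t n * f ^ n) {1..}) m =
         mps_coeff (1 + formal_sum (\<lambda>n. t n * g ^ n) {1..}) m"
proof -
  have "mps_coeff (f ^ Suc v) (m - {#v#}) = mps_coeff (g ^ Suc v) (m - {#v#})"
    if v: "v \<in># m" for v
  proof (rule mps_coeff_power_cong)
    fix a assume "a \<subseteq># m - {#v#}"
    then have "size a \<le> size (m - {#v#})"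
      by (rule size_mset_mono)
    also have "\<dots> < size m"
      using v by (rule size_Diff1_less)
    finally show "mps_coeff f a = mps_coeff g a"
      by (rule assms)
  qed
  then show ?thesis
    unfolding mps_coeff_add mps_coeff_formal_sum_t_mult by simp
qed

lemma ex1_S_equation: "\<exists>!S :: (nat, 'a :: comm_ring_1) mps. S_equation S"
proof (rule ex_ex1I)
  define F where "F = (\<lambda>S :: (nat, 'a) mps. 1 + formal_sum (\<lambda>n. t n * S ^ n) {1..})"
  define I where "I = (\<lambda>k. (F ^^ k) 0)"
  have stable: "mps_coeff (I k) m = mps_coeff (I (Suc (size m))) m" if "size m < k" for k m
    using that
  proof (induction "size m" arbitrary: k m rule: less_induct)
    case less
    then obtain k' where k: "k = Suc k'"
      by (cases k) auto
    have "mps_coeff (I k') a = mps_coeff (I (size m)) a" if "size a < size m" for a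
      using less.hyps[OF that, of k'] less.hyps[OF that, of "size m"] that less.prems k by simp
    then show ?case
      using S_step_cong[of m "I k'" "I (size m)"] by (simp add: I_def F_def k)
  qed
  define S where "S = Abs_mps (\<lambda>m. mps_coeff (I (Suc (size m))) m)"
  have "mps_coeff S m = mps_coeff (F S) m" for m
  proof -
    have "mps_coeff S a = mps_coeff (I (size m)) a" if "size a < size m" for a
      using stable[OF that] by (simp add: S_def)
    then have "mps_coeff (F S) m = mps_coeff (F (I (size m))) m"
      unfolding F_def by (rule S_step_cong)
    then show ?thesis
      by (simp add: S_def I_def)
  qed
  then have "S_equation S"
    by (auto simp: S_equation_def F_def intro: mps_eqI)
  then show "\<exists>S :: (nat, 'a) mps. S_equation S" ..
next
  fix S S' :: "(nat, 'a) mps"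
  assume eqs: "S_equation S" "S_equation S'"
  have "mps_coeff S m = mps_coeff S' m" for m
  proof (induction "size m" arbitrary: m rule: less_induct)
    case less
    show ?case
      using S_step_cong[OF less.hyps] eqs unfolding S_equation_def by metis
  qed
  then show "S = S'"
    by (rule mps_eqI)
qed

definition S :: "(nat, 'a :: comm_ring_1) mps" where
  "S = (THE S. S_equation S)"

lemma S_equation_S: "S_equation S"
  unfolding S_def using ex1_S_equation by (rule theI')

definition S1 :: "(nat, 'a :: comm_ring_1) mps" where
  "S1 = formal_sum t {1..}"

lemma formally_summable_t: "formally_summable t {1..}"
  using formally_summable_t_mult[of "\<lambda>_. 1"] by simp

lemma S1_nonzero: "S1 \<noteq> 0"
proof -
  have "mps_coeff S1 {#0#} = 1"
    using mps_coeff_formal_sum_t_mult[of "\<lambda>_. 1" "{#0#}"] by (simp add: S1_def mps_coeff_one)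
  then show ?thesis
    by (metis mps_coeff_zero zero_neq_one)
qed

lemma S_nonzero: "S \<noteq> 0"
proof -
  have "mps_coeff S {#} = 1"
    using S_equation_S unfolding S_equation_def
    by (subst (asm) mps_eq_iff, drule_tac spec[of _ "{#}"])
       (simp only: mps_coeff_add mps_coeff_formal_sum_t_mult mps_coeff_one, simp)
  then show ?thesis
    by (metis mps_coeff_zero zero_neq_one)
qed

definition G :: "(nat, 'a :: idom) mps fract" where
  "G = to_fract (S - 1) / to_fract S1"

definition H :: "(nat, 'a :: idom) mps fract" where
  "H = G / to_fract S"


section \<open>Paths\<close>

definition paths :: "int list set" where
  "paths = {P. \<forall>s\<in>set P. s \<ge> -1}"

definition positive :: "int list \<Rightarrow> bool" where
  "positive P \<longleftrightarrow> (\<forall>i\<in>{1..length P}. sum_list (take i P) > 0)"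

definition positive_paths :: "int list set" where
  "positive_paths = {P \<in> paths. positive P}"

definition step_weight :: "int \<Rightarrow> (nat, 'a :: comm_ring_1) mps" where
  "step_weight s = (if s = -1 then 1 else t (nat s + 1))"

definition path_weight :: "int list \<Rightarrow> (nat, 'a :: comm_ring_1) mps" where
  "path_weight P = prod_list (map step_weight P)"

definition generating_function :: "int list set \<Rightarrow> (nat, 'a :: comm_ring_1) mps" where
  "generating_function A = formal_sum path_weight A"

end

theory Submission
  imports Defs
begin

text \<open>
  Deleting the final down step of a first-passage path from 1 to 0 gives a path that stays
  nonnegative and ends at 0, and splitting a first-passage path at its first visits to the lower
  levels gives the equation of \<open>S\<close>; so \<open>S\<close> counts the nonnegative paths ending at 0.
  Splitting a nonnegative path at its last visit to 0 shows that \<open>S\<close> times the series of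
  positive paths counts all nonnegative paths.  Finally, a nonempty nonnegative path ending at 0 is
  a nonnegative path, followed by a step \<open>n \<ge> 0\<close>, followed by the down steps that lead back to 0;
  as down steps have weight 1, the series of nonnegative paths times \<open>S1\<close> is \<open>S - 1\<close>.
\<close>

section \<open>Generating functions as counting series\<close>

text \<open>A step \<open>s\<close> with \<open>s \<ge> 0\<close> has weight
  \<open>t (nat s + 1)\<close>, the variable with index \<open>nat s\<close>, hence no shift here.
  Down steps have weight 1 and leave no trace.\<close>

definition monomial :: "int list \<Rightarrow> nat multiset" where
  "monomial P = mset (map nat (filter (\<lambda>s. s \<ge> 0) P))"

lemma monomial_simps [simp]:
  "monomial [] = {#}"
  "monomial (s # P) = (if s \<ge> 0 then {#nat s#} else {#}) + monomial P"
  "monomial (P @ Q) = monomial P + monomial Q"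
  "monomial (replicate k (- 1)) = {#}"
  by (auto simp: monomial_def)

lemma mps_coeff_path_weight:
  assumes "P \<in> paths"
  shows "mps_coeff (path_weight P :: (nat, 'a :: comm_ring_1) mps) m =
    (if monomial P = m then 1 else 0)"
  using assms
proof (induction P arbitrary: m)
  case Nil
  then show ?case
    by (auto simp: path_weight_def mps_coeff_one)
next
  case (Cons s P)
  then have P: "P \<in> paths" and s: "s \<ge> -1"
    by (auto simp: paths_def)
  have eq: "path_weight (s # P) = step_weight s * (path_weight P :: (nat, 'a) mps)"
    by (simp add: path_weight_def)
  show ?case
  proof (cases "s = -1")
    case True
    then show ?thesis
      unfolding eq using Cons.IH[OF P] by (simp add: step_weight_def)
  next
    case False
    with s have "s \<ge> 0"
      by simp
    have "mps_coeff (path_weight (s # P) :: (nat, 'a) mps) m =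
        (if nat s \<in># m then mps_coeff (path_weight P) (m - {#nat s#}) else 0)"
      using False by (simp add: eq step_weight_def mps_coeff_t_mult)
    then show ?thesis
      using \<open>s \<ge> 0\<close> by (auto simp: Cons.IH[OF P])
  qed
qed

definition fiber :: "int list set \<Rightarrow> nat multiset \<Rightarrow> int list set" where
  "fiber A m = {P \<in> A. monomial P = m}"

text \<open>Finitely many paths per monomial: this makes the sum of the weights meaningful and lets
  cardinalities of fibers be added.\<close>

definition finite_fibers :: "int list set \<Rightarrow> bool" where
  "finite_fibers A \<longleftrightarrow> A \<subseteq> paths \<and> (\<forall>m. finite (fiber A m))"

lemma formally_summable_path_weight:
  assumes "finite_fibers A"
  shows "formally_summable (path_weight :: int list \<Rightarrow> (nat, 'a :: comm_ring_1) mps) A"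
  unfolding formally_summable_def
proof
  fix m
  have "{P \<in> A. mps_coeff (path_weight P :: (nat, 'a) mps) m \<noteq> 0} \<subseteq> fiber A m"
    using assms by (auto simp: fiber_def finite_fibers_def mps_coeff_path_weight subset_eq
        split: if_splits)
  then show "finite {P \<in> A. mps_coeff (path_weight P :: (nat, 'a) mps) m \<noteq> 0}"
    by (rule finite_subset) (use assms in \<open>simp add: finite_fibers_def\<close>)
qed

text \<open>Each path in the fiber contributes 1. For an infinite fiber both the sum and
  \<open>card\<close> are 0 by convention.\<close>

lemma mps_coeff_generating_function:
  assumes "A \<subseteq> paths"
  shows "mps_coeff (generating_function A :: (nat, 'a :: comm_ring_1) mps) m =
    of_nat (card (fiber A m))"
proof -
  have "{P. P \<in> A \<and> mps_coeff (path_weight P :: (nat, 'a) mps) m \<noteq> 0} = fiber A m"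
    using assms by (auto simp: fiber_def mps_coeff_path_weight subset_eq split: if_splits)
  then have "mps_coeff (generating_function A :: (nat, 'a) mps) m =
      (\<Sum>P\<in>fiber A m. mps_coeff (path_weight P) m)"
    by (simp add: generating_function_def formal_sum_def)
  also have "\<dots> = (\<Sum>P\<in>fiber A m. 1)"
    using assms by (intro sum.cong) (auto simp: fiber_def mps_coeff_path_weight subset_eq)
  finally show ?thesis
    by simp
qed

text \<open>A down step adds 0 to either side, and a step \<open>s \<ge> 0\<close> adds
  \<open>s + 1\<close> to either side. So monomial and endpoint together control the length.\<close>

lemma length_le_monomial:
  assumes "P \<in> paths"
  shows "int (length P) + sum_list P \<le> int (size (monomial P)) + int (\<Sum>\<^sub># (monomial P))"
  using assms by (induction P) (auto simp: paths_def)

text \<open>The monomial fixes the nonnegative steps up to order, and a lower bound on the endpoint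
  limits the number of down steps.\<close>

lemma finite_fibers_bounded_below:
  assumes "A \<subseteq> paths" and "\<And>P. P \<in> A \<Longrightarrow> sum_list P \<ge> - c"
  shows "finite_fibers A"
proof -
  have "finite (fiber A m)" for m
  proof (rule finite_subset)
    \<comment> \<open>The bound of \<open>length_le_monomial\<close> for an endpoint that is at
      least \<open>- c\<close>.\<close>
    let ?n = "nat (int (size m) + int (\<Sum>\<^sub># m) + c)"
    show "fiber A m \<subseteq> {P. set P \<subseteq> insert (-1) (int ` set_mset m) \<and> length P \<le> ?n}"
    proof
      fix P assume "P \<in> fiber A m"
      then have P: "P \<in> A" "P \<in> paths" "monomial P = m"
        using assms(1) by (auto simp: fiber_def)
      have "s \<in> insert (-1) (int ` set_mset m)" if "s \<in> set P" for s
      proof (cases "s = -1")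
        case False
        with that P have "s \<ge> 0"
          by (force simp: paths_def)
        then show ?thesis
          using that P(3)
          by (intro insertI2 image_eqI[of _ _ "nat s"]) (auto simp: monomial_def)
      qed simp
      moreover have "length P \<le> ?n"
        using length_le_monomial[OF P(2)] assms(2)[OF P(1)] P(3) by simp
      ultimately show "P \<in> {P. set P \<subseteq> insert (-1) (int ` set_mset m) \<and> length P \<le> ?n}"
        by auto
    qed
    show "finite {P. set P \<subseteq> insert (-1) (int ` set_mset m) \<and> length P \<le> ?n}"
      by (rule finite_lists_length_le) simp
  qed
  with assms(1) show ?thesis
    by (simp add: finite_fibers_def)
qed

section \<open>Bijections, unions and concatenations of sets of paths\<close>

lemma generating_function_bij:
  assumes "bij_betw h A B" and "A \<subseteq> paths" and "B \<subseteq> paths"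
    and "\<And>P. P \<in> A \<Longrightarrow> monomial (h P) = monomial P"
  shows "generating_function A = generating_function B"
proof (rule mps_eqI)
  fix m
  have "h ` fiber A m = fiber B m"
    using assms(1,4) by (auto simp: fiber_def bij_betw_def image_iff)
  moreover have "inj_on h (fiber A m)"
    using assms(1) by (auto simp: fiber_def bij_betw_def inj_on_def)
  ultimately have "card (fiber A m) = card (fiber B m)"
    by (metis card_image)
  then show "mps_coeff (generating_function A) m = mps_coeff (generating_function B) m"
    using assms by (simp add: mps_coeff_generating_function)
qed

lemma generating_function_Nil: "generating_function {[]} = 1"
proof (rule mps_eqI)
  fix m
  have "fiber {[]} m = (if m = {#} then {[]} else {})"
    by (auto simp: fiber_def)
  then show "mps_coeff (generating_function {[]}) m = mps_coeff 1 m"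
    by (simp add: mps_coeff_generating_function paths_def mps_coeff_one)
qed

lemma generating_function_Un:
  assumes "finite_fibers A" and "finite_fibers B" and "A \<inter> B = {}"
  shows "generating_function (A \<union> B) = generating_function A + generating_function B"
proof (rule mps_eqI)
  fix m
  have "fiber (A \<union> B) m = fiber A m \<union> fiber B m" "fiber A m \<inter> fiber B m = {}"
    using assms(3) by (auto simp: fiber_def)
  then show "mps_coeff (generating_function (A \<union> B)) m =
      mps_coeff (generating_function A + generating_function B) m"
    using assms by (simp add: mps_coeff_generating_function finite_fibers_def card_Un_disjoint)
qed

text \<open>The bijection says that each path of \<open>C\<close> factors uniquely into a path of
  \<open>A\<close> and a path of \<open>B\<close>. Grouping the factorizations by the monomials of
  the two factors gives the convolution over \<open>splits m\<close>.\<close>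

lemma generating_function_append:
  assumes "finite_fibers A" and "finite_fibers B"
    and "bij_betw (\<lambda>(P, Q). P @ Q) (A \<times> B) C"
  shows "generating_function C = generating_function A * generating_function B"
proof (rule mps_eqI)
  fix m
  let ?app = "\<lambda>(P, Q). P @ Q :: int list"
  have paths: "A \<subseteq> paths" "B \<subseteq> paths"
    using assms by (auto simp: finite_fibers_def)
  have img: "C = ?app ` (A \<times> B)" and inj: "inj_on ?app (A \<times> B)"
    using assms(3) by (auto simp: bij_betw_def)
  have C: "C \<subseteq> paths"
    using paths unfolding img by (fastforce simp: paths_def)
  let ?U = "\<Union>(a, b)\<in>splits m. fiber A a \<times> fiber B b"
  have U: "?U = {(P, Q). P \<in> A \<and> Q \<in> B \<and> monomial P + monomial Q = m}"
    by (auto simp: fiber_def splits_def)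
  have "fiber C m = ?app ` ?U"
    unfolding U img by (auto simp: fiber_def)
  moreover have "inj_on ?app ?U"
    using inj by (rule inj_on_subset) (auto simp: U)
  ultimately have "card (fiber C m) = card ?U"
    by (simp add: card_image)
  also have "\<dots> = (\<Sum>(a, b)\<in>splits m. card (fiber A a \<times> fiber B b))"
    unfolding case_prod_unfold using assms
    by (intro card_UN_disjoint) (auto simp: finite_fibers_def fiber_def prod_eq_iff)
  finally show "mps_coeff (generating_function C :: (nat, 'a) mps) m =
      mps_coeff (generating_function A * generating_function B) m"
    using paths C
    by (simp add: mps_coeff_generating_function mps_coeff_mult card_cartesian_product
        case_prod_unfold)
qed

definition up_steps :: "int list set" where
  "up_steps = {[s] | s. s \<ge> 0}"

lemma finite_fibers_up_steps: "finite_fibers up_steps"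
  by (rule finite_fibers_bounded_below[of _ 0]) (auto simp: up_steps_def paths_def)

text \<open>The path \<open>[s]\<close> contributes the variable with index \<open>nat s\<close>, so
  each variable arises exactly once.\<close>

lemma generating_function_up_steps: "generating_function up_steps = S1"
proof (rule mps_eqI)
  fix m :: "nat multiset"
  have coeff_S1: "mps_coeff (S1 :: (nat, 'a) mps) m =
      (\<Sum>v\<in>set_mset m. if m - {#v#} = {#} then 1 else 0)"
    using mps_coeff_formal_sum_t_mult[of "\<lambda>_. 1 :: (nat, 'a) mps" m]
    by (simp add: S1_def mps_coeff_one)
  have eq: "mps_coeff (generating_function up_steps :: (nat, 'a) mps) m = of_nat (card (fiber up_steps m))"
    using finite_fibers_up_steps by (simp add: mps_coeff_generating_function finite_fibers_def)
  show "mps_coeff (generating_function up_steps) m = mps_coeff (S1 :: (nat, 'a) mps) m"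
  proof (cases "\<exists>v. m = {#v#}")
    case True
    then obtain v where m: "m = {#v#}" ..
    then have "fiber up_steps m = {[int v]}"
      by (force simp: fiber_def up_steps_def)
    then show ?thesis
      unfolding eq coeff_S1 by (simp add: m)
  next
    case False
    then have "fiber up_steps m = {}"
      by (auto simp: fiber_def up_steps_def)
    moreover have "m - {#v#} \<noteq> {#}" if "v \<in># m" for v
      using False that by (metis insert_DiffM)
    ultimately show ?thesis
      unfolding eq coeff_S1 by simp
  qed
qed

section \<open>First-passage paths\<close>

text \<open>Paths from height \<open>h\<close> that reach 0 for the first time at their end: the
  height is positive before every step. For \<open>h < 0\<close> there are none.\<close>

fun descends :: "int \<Rightarrow> int list \<Rightarrow> bool" where
  "descends h [] \<longleftrightarrow> h = 0"
| "descends h (s # P) \<longleftrightarrow> h > 0 \<and> s \<ge> -1 \<and> descends (h + s) P"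

definition passage :: "nat \<Rightarrow> int list set" where
  "passage k = {P. descends (int k) P}"

lemma descends_zero [simp]: "descends 0 P \<longleftrightarrow> P = []"
  by (cases P) auto

lemma descends_paths: "descends h P \<Longrightarrow> P \<in> paths"
  by (induction P arbitrary: h) (auto simp: paths_def)

lemma descends_sum: "descends h P \<Longrightarrow> sum_list P = - h"
  by (induction P arbitrary: h) fastforce+

lemma finite_fibers_passage: "finite_fibers (passage k)"
  by (rule finite_fibers_bounded_below[of _ "int k"])
     (auto simp: passage_def descends_paths descends_sum)

text \<open>Raising the first path by \<open>b \<ge> 0\<close> keeps it positive, and it ends at
  height \<open>b\<close>, where the second path takes over.\<close>

lemma descends_append:
  assumes "descends a P" and "descends b Q" and "b \<ge> 0"
  shows "descends (a + b) (P @ Q)"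
  using assms(1)
proof (induction P arbitrary: a)
  case (Cons s P)
  then have "descends (a + s + b) (P @ Q)"
    by auto
  with Cons.prems assms(3) show ?case
    by (simp add: algebra_simps)
qed (use assms in simp)

text \<open>Steps go down by at most 1, so the path cannot jump over level \<open>b\<close>; it is
  cut at its first visit there. In the induction \<open>a\<close> is the current height above
  \<open>b\<close>.\<close>

lemma descends_split:
  assumes "descends (a + b) R" and "a \<ge> 0" and "b \<ge> 0"
  shows "\<exists>P Q. R = P @ Q \<and> descends a P \<and> descends b Q"
  using assms
proof (induction R arbitrary: a)
  case Nil
  then show ?case
    by simp
next
  case (Cons s R)
  show ?case
  proof (cases "a = 0")
    case True
    with Cons.prems show ?thesis
      by (intro exI[of _ "[]"] exI[of _ "s # R"]) simp
  next
    case False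
    then obtain P Q where "R = P @ Q" "descends (a + s) P" "descends b Q"
      using Cons.prems Cons.IH[of "a + s"] by (auto simp: algebra_simps)
    with False Cons.prems show ?thesis
      by (intro exI[of _ "s # P"] exI[of _ Q]) simp
  qed
qed

text \<open>The first arrival at 0 is determined by the steps read so far, so no first-passage path
  from \<open>a\<close> is a proper prefix of another.\<close>

lemma descends_append_cancel:
  assumes "descends a P" and "descends a P'" and "P @ Q = P' @ Q'"
  shows "P = P'"
  using assms
proof (induction P arbitrary: a P')
  case (Cons s P)
  then show ?case
    by (cases P') auto
qed simp

text \<open>A path from height \<open>Suc k\<close> is cut at its first visit to level
  \<open>k\<close>; the part before the cut, lowered by \<open>k\<close>, is a first passage from
  1.\<close>

lemma generating_function_passage: "generating_function (passage k) = generating_function (passage 1) ^ k"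
proof (induction k)
  case 0
  have "passage 0 = {[]}"
    by (auto simp: passage_def)
  then show ?case
    by (simp add: generating_function_Nil)
next
  case (Suc k)
  have "bij_betw (\<lambda>(P, Q). P @ Q) (passage 1 \<times> passage k) (passage (Suc k))"
    unfolding bij_betw_def
  proof
    show "inj_on (\<lambda>(P, Q). P @ Q) (passage 1 \<times> passage k)"
    proof (rule inj_onI, clarify)
      fix P Q P' Q'
      assume *: "P \<in> passage 1" "P' \<in> passage 1" "P @ Q = P' @ Q'"
      then have "P = P'"
        unfolding passage_def by (blast intro: descends_append_cancel)
      with * show "P = P' \<and> Q = Q'"
        by simp
    qed
    show "(\<lambda>(P, Q). P @ Q) ` (passage 1 \<times> passage k) = passage (Suc k)"
    proof (intro equalityI subsetI)
      fix R assume "R \<in> (\<lambda>(P, Q). P @ Q) ` (passage 1 \<times> passage k)"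
      then show "R \<in> passage (Suc k)"
        using descends_append[of 1 _ "int k"] by (auto simp: passage_def)
    next
      fix R assume "R \<in> passage (Suc k)"
      then show "R \<in> (\<lambda>(P, Q). P @ Q) ` (passage 1 \<times> passage k)"
        using descends_split[of 1 "int k" R] by (force simp: passage_def)
    qed
  qed
  then show ?case
    unfolding power_Suc Suc.IH[symmetric]
    by (rule generating_function_append[OF finite_fibers_passage finite_fibers_passage])
qed

text \<open>Split by the first step from height 1: a down step ends the path at once, and a step
  \<open>v \<ge> 0\<close> leads to height \<open>Suc v\<close>, leaving a first passage from
  there.\<close>

lemma fiber_passage_one:
  "fiber (passage 1) m = (if m = {#} then {[-1]} else {}) \<union>
    (\<Union>v\<in>set_mset m. (#) (int v) ` fiber (passage (Suc v)) (m - {#v#}))"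
    (is "?L = ?R")
proof (intro equalityI subsetI)
  fix P assume "P \<in> ?L"
  then have P: "descends 1 P" "monomial P = m"
    by (auto simp: fiber_def passage_def)
  then obtain s Q where PQ: "P = s # Q" "s \<ge> -1" "descends (1 + s) Q"
    by (cases P) auto
  show "P \<in> ?R"
  proof (cases "s = -1")
    case True
    with P PQ show ?thesis
      by auto
  next
    case False
    with PQ obtain v where v: "s = int v"
      by (cases s) auto
    with P PQ have "v \<in># m" "Q \<in> fiber (passage (Suc v)) (m - {#v#})"
      by (auto simp: fiber_def passage_def)
    with v PQ(1) show ?thesis
      by auto
  qed
next
  fix P assume "P \<in> ?R"
  then show "P \<in> ?L"
    by (auto simp: fiber_def passage_def split: if_splits)
qed

text \<open>Counting by the first step: the step \<open>v\<close> gives the factor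
  \<open>t (Suc v)\<close>, and the remaining first passage from \<open>Suc v\<close> gives the
  power with the same exponent.\<close>

lemma S_equation_passage: "S_equation (generating_function (passage 1))"
  unfolding S_equation_def
proof (rule mps_eqI)
  fix m :: "nat multiset"
  let ?g = "generating_function (passage 1) :: (nat, 'a) mps"
  let ?U = "\<Union>v\<in>set_mset m. (#) (int v) ` fiber (passage (Suc v)) (m - {#v#})"
  have fin: "finite (fiber (passage k) a)" for k a
    using finite_fibers_passage by (simp add: finite_fibers_def)
  have coeff: "mps_coeff (generating_function (passage k) :: (nat, 'a) mps) a =
      of_nat (card (fiber (passage k) a))" for k a
    using finite_fibers_passage by (simp add: mps_coeff_generating_function finite_fibers_def)
  have "card (fiber (passage 1) m) = card (if m = {#} then {[-1 :: int]} else {}) + card ?U"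
    unfolding fiber_passage_one by (rule card_Un_disjoint) (auto simp: fin)
  also have "card ?U = (\<Sum>v\<in>set_mset m. card ((#) (int v) ` fiber (passage (Suc v)) (m - {#v#})))"
    by (rule card_UN_disjoint) (auto simp: fin)
  also have "\<dots> = (\<Sum>v\<in>set_mset m. card (fiber (passage (Suc v)) (m - {#v#})))"
    by (simp add: card_image)
  finally have "mps_coeff ?g m = mps_coeff 1 m +
      (\<Sum>v\<in>set_mset m. mps_coeff (generating_function (passage (Suc v))) (m - {#v#}))"
    unfolding coeff by (simp add: mps_coeff_one)
  also have "\<dots> = mps_coeff (1 + formal_sum (\<lambda>n. t n * ?g ^ n) {1..}) m"
    unfolding mps_coeff_add mps_coeff_formal_sum_t_mult
    by (subst generating_function_passage) (rule refl)
  finally show "mps_coeff ?g m = mps_coeff (1 + formal_sum (\<lambda>n. t n * ?g ^ n) {1..}) m" .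
qed

lemma generating_function_passage_one: "generating_function (passage 1) = S"
  using S_equation_passage S_equation_S ex1_S_equation by blast

section \<open>Nonnegative paths\<close>

fun nonneg_from :: "int \<Rightarrow> int list \<Rightarrow> bool" where
  "nonneg_from h [] \<longleftrightarrow> h \<ge> 0"
| "nonneg_from h (s # P) \<longleftrightarrow> h \<ge> 0 \<and> s \<ge> -1 \<and> nonneg_from (h + s) P"

definition nonneg_paths :: "int list set" where
  "nonneg_paths = {P. nonneg_from 0 P}"

definition excursions :: "int list set" where
  "excursions = {P \<in> nonneg_paths. sum_list P = 0}"

lemma nonneg_from_append:
  "nonneg_from h (P @ Q) \<longleftrightarrow> nonneg_from h P \<and> nonneg_from (h + sum_list P) Q"
proof (induction P arbitrary: h)
  case Nil
  then show ?case
    by (cases Q) auto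
qed (auto simp: algebra_simps)

lemma nonneg_from_paths: "nonneg_from h P \<Longrightarrow> P \<in> paths"
  by (induction P arbitrary: h) (auto simp: paths_def)

lemma nonneg_from_sum: "nonneg_from h P \<Longrightarrow> h + sum_list P \<ge> 0"
  by (induction P arbitrary: h) (auto simp: algebra_simps, fastforce)

lemma nonneg_from_replicate: "nonneg_from h (replicate k (-1)) \<longleftrightarrow> h \<ge> int k"
  by (induction k arbitrary: h) auto

lemma finite_fibers_nonneg_paths: "finite_fibers nonneg_paths"
  using nonneg_from_sum[of 0]
  by (intro finite_fibers_bounded_below[of _ 0]) (auto simp: nonneg_paths_def nonneg_from_paths)

lemma finite_fibers_mono:
  assumes "finite_fibers B" and "A \<subseteq> B"
  shows "finite_fibers A"
proof -
  have "fiber A m \<subseteq> fiber B m" for m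
    using assms(2) by (auto simp: fiber_def)
  with assms show ?thesis
    unfolding finite_fibers_def by (meson finite_subset subset_trans)
qed

section \<open>Excursions and first-passage paths\<close>

lemma finite_fibers_excursions: "finite_fibers excursions"
  by (rule finite_fibers_mono[OF finite_fibers_nonneg_paths]) (auto simp: excursions_def)

text \<open>Heights at least 1 before every step become heights at least 0 after lowering by 1. The
  last down step must start from height 1.\<close>

lemma descends_snoc_down:
  "descends h (P @ [-1]) \<longleftrightarrow> nonneg_from (h - 1) P \<and> h + sum_list P = 1"
proof (induction P arbitrary: h)
  case (Cons s P)
  show ?case
    using Cons.IH[of "h + s"] by (auto simp: algebra_simps)
qed auto

text \<open>The step that brings a positive height to 0 is negative, hence equal to -1.\<close>

lemma descends_last:
  assumes "descends h P" and "h > 0"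
  shows "\<exists>Q. P = Q @ [-1]"
  using assms
proof (induction P arbitrary: h)
  case (Cons s P)
  show ?case
  proof (cases "h + s = 0")
    case True
    with Cons.prems have "s # P = [] @ [-1]"
      by auto
    then show ?thesis ..
  next
    case False
    with Cons.prems have "h + s > 0" "descends (h + s) P"
      by auto
    with Cons.IH[of "h + s"] obtain Q where "P = Q @ [-1]"
      by blast
    then have "s # P = (s # Q) @ [-1]"
      by simp
    then show ?thesis ..
  qed
qed simp

lemma generating_function_excursions: "generating_function excursions = S"
proof -
  have "bij_betw (\<lambda>P. P @ [-1]) excursions (passage 1)"
    unfolding bij_betw_def
  proof
    show "(\<lambda>P. P @ [-1]) ` excursions = passage 1"
    proof (intro equalityI subsetI)
      fix P assume "P \<in> passage 1"
      then have P: "descends 1 P"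
        by (simp add: passage_def)
      with descends_last[of 1 P] obtain Q where "P = Q @ [-1]"
        by auto
      with P show "P \<in> (\<lambda>P. P @ [-1]) ` excursions"
        using descends_snoc_down[of 1 Q] by (auto simp: excursions_def nonneg_paths_def)
    qed (auto simp: excursions_def nonneg_paths_def passage_def descends_snoc_down)
  qed (simp add: inj_on_def)
  then have "generating_function excursions = (generating_function (passage 1) :: (nat, 'a) mps)"
    by (rule generating_function_bij)
       (use finite_fibers_excursions finite_fibers_passage in \<open>auto simp: finite_fibers_def\<close>)
  then show ?thesis
    by (simp only: generating_function_passage_one)
qed

section \<open>Positive paths and the last visit to 0\<close>

lemma positive_append_iff:
  "positive P \<longleftrightarrow> (\<forall>Q R. P = Q @ R \<longrightarrow> Q \<noteq> [] \<longrightarrow> sum_list Q > 0)"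
proof (intro iffI allI impI)
  fix Q R assume "positive P" "P = Q @ R" "Q \<noteq> []"
  then show "sum_list Q > 0"
    by (auto simp: positive_def Suc_le_eq dest!: bspec[of _ _ "length Q"])
next
  assume *: "\<forall>Q R. P = Q @ R \<longrightarrow> Q \<noteq> [] \<longrightarrow> sum_list Q > 0"
  show "positive P"
    unfolding positive_def
  proof
    fix i assume "i \<in> {1..length P}"
    then have "P = take i P @ drop i P" "take i P \<noteq> []"
      by auto
    with * show "sum_list (take i P) > 0"
      by blast
  qed
qed

lemma positive_Nil: "positive []"
  by (simp add: positive_def)

lemma positive_snoc: "positive (P @ [s]) \<longleftrightarrow> positive P \<and> sum_list P + s > 0"
proof -
  have "{1..length (P @ [s])} = insert (Suc (length P)) {1..length P}"
    by auto
  then show ?thesis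
    by (auto simp: positive_def)
qed

lemma positive_imp_nonneg_from:
  assumes "P \<in> paths" and "positive P"
  shows "nonneg_from 0 P"
  using assms
  by (induction P rule: rev_induct)
     (auto simp: positive_snoc nonneg_from_append paths_def dest: nonneg_from_sum)

lemma finite_fibers_positive_paths: "finite_fibers positive_paths"
  by (rule finite_fibers_mono[OF finite_fibers_nonneg_paths])
     (auto simp: positive_paths_def nonneg_paths_def positive_imp_nonneg_from)

text \<open>Adding one step at the end either returns to 0, so that the whole path becomes the
  excursion, or extends the positive part.\<close>

lemma nonneg_path_split_last_zero:
  assumes "R \<in> nonneg_paths"
  shows "\<exists>P Q. R = P @ Q \<and> P \<in> excursions \<and> Q \<in> positive_paths"
  using assms
proof (induction R rule: rev_induct)
  case Nil
  then show ?case
    by (simp add: excursions_def positive_paths_def positive_Nil paths_def)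
next
  case (snoc s R)
  show ?case
  proof (cases "sum_list (R @ [s]) = 0")
    case True
    with snoc.prems have "R @ [s] \<in> excursions" "[] \<in> positive_paths"
      by (auto simp: excursions_def positive_paths_def positive_Nil paths_def)
    then show ?thesis
      by (metis append_Nil2)
  next
    case False
    have R: "R \<in> nonneg_paths" "s \<ge> -1" "sum_list R + s > 0"
      using snoc.prems False by (auto simp: nonneg_paths_def nonneg_from_append)
    with snoc.IH obtain P Q where PQ: "R = P @ Q" "P \<in> excursions" "Q \<in> positive_paths"
      by blast
    \<comment> \<open>Since \<open>P\<close> sums to 0, \<open>Q\<close> and \<open>R\<close> have
      the same sum.\<close>
    then have "Q @ [s] \<in> positive_paths"
      using R by (auto simp: positive_paths_def positive_snoc excursions_def paths_def)
    with PQ have "R @ [s] = P @ (Q @ [s]) \<and> P \<in> excursions \<and> Q @ [s] \<in> positive_paths"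
      by simp
    then show ?thesis
      by blast
  qed
qed

lemma generating_function_nonneg_paths:
  "generating_function nonneg_paths = S * generating_function positive_paths"
proof -
  have "bij_betw (\<lambda>(P, Q). P @ Q) (excursions \<times> positive_paths) nonneg_paths"
    unfolding bij_betw_def
  proof
    show "inj_on (\<lambda>(P, Q). P @ Q) (excursions \<times> positive_paths)"
    proof (rule inj_onI, clarify)
      fix P Q P' Q'
      assume *: "P \<in> excursions" "P' \<in> excursions" "Q \<in> positive_paths" "Q' \<in> positive_paths"
        and "P @ Q = P' @ Q'"
      \<comment> \<open>If the cuts differ, the block \<open>X\<close> between them is a nonempty
        prefix of one of the positive paths, yet it sums to 0 as the difference of two
        excursions.\<close>
      then consider X where "P = P' @ X" "X @ Q = Q'" | X where "P @ X = P'" "Q = X @ Q'"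
        by (auto simp: append_eq_append_conv2)
      then show "P = P' \<and> Q = Q'"
        using * by cases (force simp: excursions_def positive_paths_def positive_append_iff)+
    qed
    show "(\<lambda>(P, Q). P @ Q) ` (excursions \<times> positive_paths) = nonneg_paths"
      using nonneg_path_split_last_zero
      by (force simp: excursions_def nonneg_paths_def nonneg_from_append positive_paths_def
          positive_imp_nonneg_from)
  qed
  from generating_function_append[OF finite_fibers_excursions finite_fibers_positive_paths this]
  show ?thesis
    by (simp add: generating_function_excursions)
qed

section \<open>The last up step of an excursion\<close>

lemma nonneg_path_split_last_up:
  assumes "P \<in> nonneg_paths" and "P \<noteq> []"
  shows "\<exists>Q s k. P = Q @ [s] @ replicate k (-1) \<and> s \<ge> 0"
  using assms
proof (induction P rule: rev_induct)
  case (snoc s P)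
  show ?case
  proof (cases "s \<ge> 0")
    case True
    then have "P @ [s] = P @ [s] @ replicate 0 (-1) \<and> s \<ge> 0"
      by simp
    then show ?thesis
      by blast
  next
    case False
    \<comment> \<open>\<open>P\<close> is nonempty because a down step from 0 would go below
      0.\<close>
    with snoc.prems have s: "s = -1" and "P \<in> nonneg_paths" "P \<noteq> []"
      by (auto simp: nonneg_paths_def nonneg_from_append)
    with snoc.IH obtain Q r k where "P = Q @ [r] @ replicate k (-1)" "r \<ge> 0"
      by blast
    then have "P @ [s] = Q @ [r] @ replicate (Suc k) (-1) \<and> r \<ge> 0"
      using s by (simp add: replicate_append_same)
    then show ?thesis
      by blast
  qed
qed simp

text \<open>\<open>A\<close> consists of the nonnegative paths ending in an up step, and
  \<open>h\<close> closes such a path by down steps, which do not change the monomial.\<close>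

lemma generating_function_nonempty_excursions:
  "generating_function (excursions - {[]}) = generating_function nonneg_paths * S1"
proof -
  define A where "A = {Q @ [s] | Q s. Q \<in> nonneg_paths \<and> s \<ge> 0}"
  define h where "h = (\<lambda>R. R @ replicate (nat (sum_list R)) (-1 :: int))"
  have "bij_betw (\<lambda>(P, Q). P @ Q) (nonneg_paths \<times> up_steps) A"
    unfolding bij_betw_def by (force simp: inj_on_def up_steps_def A_def)
  from generating_function_append[OF finite_fibers_nonneg_paths finite_fibers_up_steps this]
  have "generating_function A = generating_function nonneg_paths * (S1 :: (nat, 'a) mps)"
    by (simp add: generating_function_up_steps)
  moreover have A: "R \<in> nonneg_paths" "sum_list R \<ge> 0" if R: "R \<in> A" for R
  proof -
    obtain Q s where "R = Q @ [s]" "Q \<in> nonneg_paths" "s \<ge> 0"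
      using R by (auto simp: A_def)
    then show "R \<in> nonneg_paths"
      using nonneg_from_sum[of 0 Q] by (simp add: nonneg_paths_def nonneg_from_append)
    then show "sum_list R \<ge> 0"
      using nonneg_from_sum[of 0 R] by (simp add: nonneg_paths_def)
  qed
  have "bij_betw h A (excursions - {[]})"
    unfolding bij_betw_def
  proof
    \<comment> \<open>A path in \<open>A\<close> ends in a nonnegative step, so stripping the
      trailing down steps undoes \<open>h\<close>.\<close>
    have "R = rev (dropWhile (\<lambda>s. s = -1) (rev (h R)))" if "R \<in> A" for R
      using that by (auto simp: A_def h_def dropWhile_append)
    then show "inj_on h A"
      by (metis inj_onI)
    show "h ` A = excursions - {[]}"
    proof (intro equalityI subsetI)
      fix P assume "P \<in> h ` A"
      then obtain R where R: "R \<in> A" "P = h R"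
        by blast
      moreover have "R \<noteq> []"
        using R(1) by (auto simp: A_def)
      ultimately show "P \<in> excursions - {[]}"
        using A[OF R(1)]
        by (auto simp: h_def excursions_def nonneg_paths_def nonneg_from_append
            nonneg_from_replicate sum_list_replicate)
    next
      fix P assume P: "P \<in> excursions - {[]}"
      then obtain Q s k where Q: "P = Q @ [s] @ replicate k (-1)" "s \<ge> 0"
        using nonneg_path_split_last_up[of P] by (auto simp: excursions_def)
      \<comment> \<open>The total is 0, so the part before the \<open>k\<close> down steps ends at
        height \<open>k\<close>, and \<open>h\<close> appends exactly these steps.\<close>
      with P have "Q @ [s] \<in> A" "sum_list (Q @ [s]) = int k"
        by (auto simp: excursions_def A_def nonneg_paths_def nonneg_from_append sum_list_replicate)
      moreover from this(2) have "P = h (Q @ [s])"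
        unfolding h_def Q(1) by simp
      ultimately show "P \<in> h ` A"
        by blast
    qed
  qed
  then have "generating_function A = (generating_function (excursions - {[]}) :: (nat, 'a) mps)"
    by (rule generating_function_bij)
       (use A in \<open>auto simp: h_def nonneg_paths_def excursions_def intro: nonneg_from_paths\<close>)
  ultimately show ?thesis
    by simp
qed

text \<open>The constant 1 is the empty excursion, and the product comes from the nonempty
  ones.\<close>

lemma S_eq: "S = 1 + S * generating_function positive_paths * S1"
proof -
  have "[] \<in> excursions"
    by (simp add: excursions_def nonneg_paths_def)
  then have "S = (generating_function ({[]} \<union> (excursions - {[]})) :: (nat, 'a) mps)"
    by (simp add: generating_function_excursions insert_absorb)
  also have "\<dots> = generating_function {[]} + generating_function (excursions - {[]})"
    by (rule generating_function_Un)
       (use \<open>[] \<in> excursions\<close> in \<open>auto intro: finite_fibers_mono[OF finite_fibers_excursions]\<close>)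
  finally show ?thesis
    by (simp add: generating_function_Nil generating_function_nonempty_excursions
        generating_function_nonneg_paths)
qed

theorem theorem3p5:
  shows "formally_summable (path_weight :: int list \<Rightarrow> (nat, 'a :: idom) mps) positive_paths
    \<and> (H :: (nat, 'a) mps fract) = to_fract (generating_function positive_paths)"
proof
  show "formally_summable (path_weight :: int list \<Rightarrow> (nat, 'a) mps) positive_paths"
    by (rule formally_summable_path_weight[OF finite_fibers_positive_paths])
  have "S - 1 = (S * generating_function positive_paths * S1 :: (nat, 'a) mps)"
    using S_eq by (metis add_diff_cancel_left')
  \<comment> \<open>Equality of fractions becomes the identity just shown by cross-multiplication,
    as \<open>S\<close> and \<open>S1\<close> are nonzero.\<close>
  then show "(H :: (nat, 'a) mps fract) = to_fract (generating_function positive_paths)"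
    by (simp add: H_def G_def to_fract_def S1_nonzero S_nonzero eq_fract ac_simps)
qed

end
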